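(* Let $n\ge 1$ and $j\ge 0$ be integers. The number of permutations $\pi\in Av_n(123)$ with $\gamma^U_\pi\le j$ equals the number of Dyck paths of semi-length $n$ that avoid $U^{j+2}D$.
   Context: $\mathcal{S}_n$ is the set of permutations $\pi=\pi_1\pi_2\dots\pi_n$ of $\{1,\dots,n\}$ in one-line notation, and $Av_n(123)$ is the set of those having no increasing subsequence of length $3$. For an entry $\pi_i$ of $\pi$, let $s_\pi(\pi_i)$ be the biggest sub-string (block of consecutive positions) of $\pi$ that contains $\pi_i$ and all of whose entries are greater than or equal to $\pi_i$. The sub-permutation of $\pi$ generated by $\pi_i$, denoted $g_\pi(\pi_i)$, is the permutation obtained by rescaling $s_\pi(\pi_i)$ (replacing its entries by $1,2,\dots,|s_\pi(\pi_i)|$ in an order-preserving way). Two-line representation: the entries of $\pi\in Av_n(123)$ are split into two decreasing subsequences, an upper line $U$ and a lower line $D$. An entry belongs to $U$ if and only if it covers at least one entry of $D$, where an entry covers another one if it lies to its right and is larger. (Equivalently, $D$ consists of the left-to-right minima of $\pi$, and $U$ of all other entries.) A sub-permutation $g_\pi(\pi_i)$ is decreasing if it avoids the pattern $12$. A decreasing sub-permutation $g_\pi(\pi_i)$ of size $m$ is called trivial if it consists of the first $m$ entries of $\pi$, these all lying on $D$; it is non-trivial if it corresponds to a sequence of $m$ entries in adjacent positions all lying on $U$ (every decreasing sub-permutation is of exactly one of these two kinds). $\gamma^U_\pi$ denotes the size of the biggest non-trivial decreasing sub-permutation of $\pi$ (with $\gamma^U_\pi=0$ if there is none). A Dyck path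 of semi-length $n$ is a sequence of $n$ up steps $U$ and $n$ down steps $D$ in which every prefix contains at least as many $U$'s as $D$'s. It avoids $U^{j+2}D$ if it does not contain, as a sub-string of consecutive steps, $j+2$ steps $U$ immediately followed by a step $D$. *)

theory Defs
  imports "HOL-Library.Sublist" "HOL-Combinatorics.Multiset_Permutations"
begin

text \<open>
  A permutation of \<open>{1..n}\<close> in one-line notation is an element of \<open>permutations_of_set {1..n}\<close>,
  a list. Entries are addressed by their position, and positions start at \<open>0\<close>, so that
  the entry \<open>\<pi>\<^sub>i\<close> of the usual notation is \<open>\<pi> ! (i - 1)\<close>.
\<close>

definition avoids_increasing :: "nat \<Rightarrow> nat list \<Rightarrow> bool" where
  "avoids_increasing k xs \<longleftrightarrow> \<not> (\<exists>ys. subseq ys xs \<and> length ys = k \<and> sorted_wrt (<) ys)"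

definition Av123 :: "nat \<Rightarrow> nat list set" where
  "Av123 n = {\<pi> \<in> permutations_of_set {1..n}. avoids_increasing 3 \<pi>}"

text \<open>\<open>covers \<pi> i k\<close>: the entry at position \<open>i\<close> covers the entry at position \<open>k\<close>.\<close>

definition covers :: "nat list \<Rightarrow> nat \<Rightarrow> nat \<Rightarrow> bool" where
  "covers \<pi> i k \<longleftrightarrow> k < i \<and> \<pi> ! k < \<pi> ! i"

text \<open>
  The rule ``an entry is on the upper line iff it covers an entry of the lower line'' determines the
  two lines, by recursion on the position: an entry can only cover entries to its left.
\<close>

function on_upper :: "nat list \<Rightarrow> nat \<Rightarrow> bool" where
  "on_upper \<pi> i \<longleftrightarrow> (\<exists>k\<in>{..<i}. covers \<pi> i k \<and> \<not> on_upper \<pi> k)"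
  by pat_completeness auto
termination by (relation "measure snd") auto

declare on_upper.simps [simp del]

abbreviation on_lower :: "nat list \<Rightarrow> nat \<Rightarrow> bool" where
  "on_lower \<pi> i \<equiv> \<not> on_upper \<pi> i"

lemma on_upper_iff_covers_lower: "on_upper \<pi> i \<longleftrightarrow> (\<exists>k. covers \<pi> i k \<and> on_lower \<pi> k)"
  by (subst on_upper.simps) (auto simp: covers_def)

lemma on_lower_iff_left_to_right_minimum: "on_lower \<pi> i \<longleftrightarrow> (\<forall>k<i. \<pi> ! i \<le> \<pi> ! k)"
proof (induction i rule: less_induct)
  case (less i)
  show ?case
  proof
    assume low: "on_lower \<pi> i"
    show "\<forall>k<i. \<pi> ! i \<le> \<pi> ! k"
    proof (rule ccontr)
      assume "\<not> ?thesis"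
      then have ex: "\<exists>k. k < i \<and> \<pi> ! k < \<pi> ! i" by (auto simp: not_le)
      define k where "k = (LEAST k. k < i \<and> \<pi> ! k < \<pi> ! i)"
      have k: "k < i" "\<pi> ! k < \<pi> ! i"
        using LeastI_ex[OF ex] by (simp_all add: k_def)
      have "\<pi> ! k \<le> \<pi> ! l" if "l < k" for l
        using not_less_Least[of l "\<lambda>k. k < i \<and> \<pi> ! k < \<pi> ! i"] that k
        by (auto simp: k_def[symmetric])
      then have "on_lower \<pi> k" using less.IH k(1) by blast
      with k low show False by (auto simp: on_upper_iff_covers_lower[of \<pi> i] covers_def)
    qed
  next
    assume "\<forall>k<i. \<pi> ! i \<le> \<pi> ! k"
    then show "on_lower \<pi> i"
      by (auto simp: on_upper_iff_covers_lower[of \<pi> i] covers_def not_less[symmetric])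
  qed
qed

text \<open>
  \<open>is_block \<pi> i B\<close>: the positions \<open>B\<close> are consecutive, include \<open>i\<close>, and carry only entries greater
  than or equal to the one at \<open>i\<close>. Blocks are closed under union, so their union is the
  biggest block.
\<close>

definition is_block :: "nat list \<Rightarrow> nat \<Rightarrow> nat set \<Rightarrow> bool" where
  "is_block \<pi> i B \<longleftrightarrow>
     (\<exists>a b. B = {a..b} \<and> a \<le> i \<and> i \<le> b \<and> b < length \<pi>) \<and> (\<forall>k\<in>B. \<pi> ! i \<le> \<pi> ! k)"

definition max_block :: "nat list \<Rightarrow> nat \<Rightarrow> nat set" where
  "max_block \<pi> i = \<Union> {B. is_block \<pi> i B}"

lemma max_block_greatest: "is_block \<pi> i B \<Longrightarrow> B \<subseteq> max_block \<pi> i"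
  by (auto simp: max_block_def)

lemma is_block_max_block:
  assumes "i < length \<pi>"
  shows "is_block \<pi> i (max_block \<pi> i)"
proof -
  let ?M = "max_block \<pi> i"
  have bl: "is_block \<pi> i {i..i}"
    using assms unfolding is_block_def by (intro conjI exI[of _ i]) auto
  have i: "i \<in> ?M" using max_block_greatest[OF bl] by auto
  have sub: "?M \<subseteq> {..<length \<pi>}" by (auto simp: max_block_def is_block_def)
  then have fin: "finite ?M" using finite_subset by blast
  have ge: "\<forall>k\<in>?M. \<pi> ! i \<le> \<pi> ! k" by (auto simp: max_block_def is_block_def)
  have conv: "{min i k..max i k} \<subseteq> ?M" if "k \<in> ?M" for k
  proof -
    from that obtain B where B: "is_block \<pi> i B" "k \<in> B" by (auto simp: max_block_def)
    then have "{min i k..max i k} \<subseteq> B" by (auto simp: is_block_def)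
    then show ?thesis using max_block_greatest[OF B(1)] by blast
  qed
  have "?M = {Min ?M..Max ?M}"
  proof
    show "?M \<subseteq> {Min ?M..Max ?M}" using fin by auto
    have ne: "?M \<noteq> {}" using i by blast
    have "{Min ?M..i} \<subseteq> ?M"
      using conv[OF Min_in[OF fin ne]] Min_le[OF fin i] by (simp add: min_absorb2 max_absorb1)
    moreover have "{i..Max ?M} \<subseteq> ?M"
      using conv[OF Max_in[OF fin ne]] Max_ge[OF fin i] by (simp add: min_absorb1 max_absorb2)
    moreover have "{Min ?M..Max ?M} \<subseteq> {Min ?M..i} \<union> {i..Max ?M}" by auto
    ultimately show "{Min ?M..Max ?M} \<subseteq> ?M" by blast
  qed
  moreover have "Max ?M < length \<pi>" using sub Max_in[OF fin] i by auto
  ultimately show ?thesis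
    unfolding is_block_def using ge Min_le[OF fin i] Max_ge[OF fin i] by blast
qed

definition generated_string :: "nat list \<Rightarrow> nat \<Rightarrow> nat list" where
  "generated_string \<pi> i = nths \<pi> (max_block \<pi> i)"

text \<open>Order-preserving replacement of distinct entries by \<open>1, \<dots>, length xs\<close>.\<close>

definition rescale :: "nat list \<Rightarrow> nat list" where
  "rescale xs = map (\<lambda>x. card {y \<in> set xs. y \<le> x}) xs"

definition generated_subperm :: "nat list \<Rightarrow> nat \<Rightarrow> nat list" where
  "generated_subperm \<pi> i = rescale (generated_string \<pi> i)"

definition decreasing_subperm :: "nat list \<Rightarrow> nat \<Rightarrow> bool" where
  "decreasing_subperm \<pi> i \<longleftrightarrow> avoids_increasing 2 (generated_subperm \<pi> i)"

definition nontrivial_decreasing_subperm :: "nat list \<Rightarrow> nat \<Rightarrow> bool" where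
  "nontrivial_decreasing_subperm \<pi> i \<longleftrightarrow>
     decreasing_subperm \<pi> i \<and> (\<forall>k\<in>max_block \<pi> i. on_upper \<pi> k)"

definition gamma_U :: "nat list \<Rightarrow> nat" where
  "gamma_U \<pi> =
     Max (insert 0
       {length (generated_subperm \<pi> i) | i. i < length \<pi> \<and> nontrivial_decreasing_subperm \<pi> i})"

datatype step = Up | Down

definition dyck_paths :: "nat \<Rightarrow> step list set" where
  "dyck_paths n = {p. count_list p Up = n \<and> count_list p Down = n \<and>
     (\<forall>q. prefix q p \<longrightarrow> count_list q Down \<le> count_list q Up)}"

text \<open>\<open>sublist\<close> is the library's relation for contiguous sublists.\<close>

definition avoids_string :: "'a list \<Rightarrow> 'a list \<Rightarrow> bool" where
  "avoids_string w p \<longleftrightarrow> \<not> sublist w p"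

end

theory Submission
  imports Defs
begin

text \<open>
  A 123-avoiding permutation is determined by
  the values and positions of its left-to-right minima \<open>m\<^sub>1 > m\<^sub>2 > \<dots>\<close>, since each other entry has to be
  the largest value left. It is encoded by the Dyck path in which a new minimum \<open>m\<^sub>i\<close> contributes
  \<open>m\<^sub>i\<^sub>-\<^sub>1 - m\<^sub>i\<close> up steps (with \<open>m\<^sub>0 = n + 1\<close>) and one down step, and every other entry one down step.
  The height counts the skipped values still to be placed, and a stretch of \<open>r\<close> consecutive upper
  entries, together with the minimum before it, becomes a run of \<open>r + 1\<close> down steps. As \<open>\<gamma>\<^sup>U\<close> is the
  longest such stretch, \<open>\<gamma>\<^sup>U \<le> j\<close> means that there are no \<open>j + 2\<close> consecutive down steps; reversing
  the path turns this into the avoidance of \<open>U\<^sup>j\<^sup>+\<^sup>2D\<close>.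
\<close>

section \<open>Testing 123-avoidance by a left-to-right scan\<close>

text \<open>The entries \<open>xs\<close> follow a prefix with minimum \<open>m\<close>.\<close>

fun av123_from :: "nat \<Rightarrow> nat list \<Rightarrow> bool" where
  "av123_from m [] \<longleftrightarrow> True"
| "av123_from m (x # xs) \<longleftrightarrow>
     (if x < m then av123_from x xs else (\<forall>y\<in>set xs. y < x) \<and> av123_from m xs)"

lemma avoids_increasing_3_iff:
  "avoids_increasing 3 xs \<longleftrightarrow> (\<forall>a b c. a < b \<longrightarrow> b < c \<longrightarrow> \<not> subseq [a, b, c] xs)"
proof -
  have "length ys = 3 \<and> sorted_wrt (<) ys \<longleftrightarrow> (\<exists>a b c. ys = [a, b, c] \<and> a < b \<and> b < c)"
    for ys :: "nat list"
    by (auto simp: numeral_3_eq_3 length_Suc_conv)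
  then have "avoids_increasing 3 xs \<longleftrightarrow>
      \<not> (\<exists>ys. subseq ys xs \<and> (\<exists>a b c. ys = [a, b, c] \<and> a < b \<and> b < c))"
    unfolding avoids_increasing_def by simp
  then show ?thesis by auto
qed

lemma subseq_singleton_iff: "subseq [x] xs \<longleftrightarrow> x \<in> set xs"
  by (induction xs) auto

lemma subseq_Cons_Cons_iff:
  "subseq (y # ys) (x # xs) \<longleftrightarrow> y = x \<and> subseq ys xs \<or> subseq (y # ys) xs"
  by (metis subseq_Cons' subseq_Cons2_iff)

lemma avoids_increasing_3_Cons:
  "avoids_increasing 3 (x # xs) \<longleftrightarrow>
     avoids_increasing 3 xs \<and> (\<forall>b c. x < b \<longrightarrow> b < c \<longrightarrow> \<not> subseq [b, c] xs)"
  unfolding avoids_increasing_3_iff subseq_Cons_Cons_iff by blast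

text \<open>The last minimum is all that the scan has to remember; here \<open>m\<close> is itself
  the entry before \<open>xs\<close>. If \<open>x < m\<close>, then \<open>x\<close> can replace
  \<open>m\<close> in any increasing triple, so \<open>m\<close> may be dropped. Otherwise
  \<open>m\<close>, \<open>x\<close> and a larger later entry would form a triple; once all later
  entries are below \<open>x\<close>, no triple contains \<open>x\<close>.\<close>

lemma av123_from_iff:
  assumes "distinct (m # xs)"
  shows "av123_from m xs \<longleftrightarrow> avoids_increasing 3 (m # xs)"
  using assms
proof (induction xs arbitrary: m)
  case Nil
  then show ?case by (simp add: avoids_increasing_3_iff)
next
  case (Cons x xs)
  show ?case
  proof (cases "x < m")
    case True
    have "avoids_increasing 3 (m # x # xs) \<longleftrightarrow> avoids_increasing 3 (x # xs)"
      unfolding avoids_increasing_3_Cons[of m]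
      using True by (auto simp: avoids_increasing_3_Cons subseq_Cons_Cons_iff)
    with True Cons show ?thesis by simp
  next
    case False
    with Cons.prems have "m < x" by auto
    have "avoids_increasing 3 (m # x # xs) \<longleftrightarrow>
        (\<forall>y\<in>set xs. y < x) \<and> avoids_increasing 3 (m # xs)"
    proof
      assume A: "avoids_increasing 3 (m # x # xs)"
      then have "\<forall>y\<in>set xs. \<not> x < y"
        using \<open>m < x\<close> unfolding avoids_increasing_3_Cons[of m]
        by (simp only: subseq_Cons_Cons_iff subseq_singleton_iff) blast
      with Cons.prems have "\<forall>y\<in>set xs. y < x" by (metis distinct.simps(2) nat_neq_iff)
      moreover have "avoids_increasing 3 (m # xs)"
        using A unfolding avoids_increasing_3_Cons
        by (auto intro: list_emb_Cons simp del: subseq_Cons2_iff)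
      ultimately show "(\<forall>y\<in>set xs. y < x) \<and> avoids_increasing 3 (m # xs)" ..
    next
      assume A: "(\<forall>y\<in>set xs. y < x) \<and> avoids_increasing 3 (m # xs)"
      have 1: "\<not> subseq [b, c] xs" if "x < b" for b c
        using A that subseq_singleton_iff[of b xs] subseq_order.trans[of "[b]" "[b, c]" xs]
        by fastforce
      have 2: "\<not> subseq [b, c] (x # xs)" if "m < b" "b < c" for b c
        using A that unfolding avoids_increasing_3_Cons
        by (simp only: subseq_Cons_Cons_iff subseq_singleton_iff) (metis less_asym)
      have "avoids_increasing 3 xs" using A by (simp only: avoids_increasing_3_Cons)
      then show "avoids_increasing 3 (m # x # xs)"
        unfolding avoids_increasing_3_Cons[of m "x # xs"] avoids_increasing_3_Cons[of x xs]
        using 1 2 by (intro conjI allI impI)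
    qed
    with False Cons show ?thesis by auto
  qed
qed

text \<open>The start value exceeds every entry, so the first entry always counts as a minimum and
  the scan continues from there.\<close>

lemma av123_from_Suc_bound:
  assumes "distinct xs" "set xs \<subseteq> {1..n}"
  shows "av123_from (Suc n) xs \<longleftrightarrow> avoids_increasing 3 xs"
proof (cases xs)
  case Nil
  then show ?thesis by (simp add: avoids_increasing_3_iff)
next
  case (Cons x ys)
  with assms av123_from_iff[of x ys] show ?thesis by simp
qed

section \<open>Words with bounded runs of a letter\<close>

text \<open>\<open>d\<close>-runs have length at most \<open>J\<close>, an initial one length at most \<open>c\<close>.\<close>

fun bounded_runs :: "'a \<Rightarrow> nat \<Rightarrow> nat \<Rightarrow> 'a list \<Rightarrow> bool" where
  "bounded_runs d J c [] \<longleftrightarrow> True"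
| "bounded_runs d J c (x # xs) \<longleftrightarrow>
     (if x = d then c > 0 \<and> bounded_runs d J (c - 1) xs else bounded_runs d J J xs)"

text \<open>The induction needs an arbitrary budget \<open>c\<close> for the current run. Since
  \<open>c \<le> J\<close>, a run of \<open>J + 1\<close> copies at the very front is already
  excluded by the prefix condition.\<close>

lemma bounded_runs_iff:
  assumes "c \<le> J"
  shows "bounded_runs d J c xs \<longleftrightarrow>
    \<not> sublist (replicate (Suc J) d) xs \<and> \<not> prefix (replicate (Suc c) d) xs"
  using assms
proof (induction xs arbitrary: c)
  case (Cons x xs)
  show ?case
  proof (cases "x = d")
    case True
    show ?thesis
    proof (cases c)
      case 0
      with True show ?thesis by simp
    next
      case (Suc c')
      have "prefix (replicate (Suc c') d) (replicate J d)"
        using Suc Cons.prems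
        by (metis le_add_diff_inverse prefixI replicate_add)
      then have "\<not> prefix (replicate (Suc c') d) xs \<Longrightarrow> \<not> prefix (replicate J d) xs"
        using prefix_order.trans by blast
      then show ?thesis
        using True Suc Cons.IH[of c'] Cons.prems by (auto simp: sublist_Cons_right)
    qed
  next
    case False
    have "prefix (replicate (Suc J) d) xs \<Longrightarrow> sublist (replicate (Suc J) d) xs"
      by blast
    with False show ?thesis
      using Cons.IH[of J] by (auto simp: sublist_Cons_right)
  qed
qed simp

corollary bounded_runs_same_iff:
  "bounded_runs d J J xs \<longleftrightarrow> \<not> sublist (replicate (Suc J) d) xs"
  by (auto simp: bounded_runs_iff simp del: replicate_Suc)

lemma bounded_runs_append_replicate:
  "x \<noteq> d \<Longrightarrow> bounded_runs d J c (replicate (Suc k) x @ xs) \<longleftrightarrow> bounded_runs d J J xs"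
  by (induction k arbitrary: c) auto

lemma sublist_replicate_iff:
  "sublist (replicate (Suc j) d) xs \<longleftrightarrow> (\<exists>a. a + j < length xs \<and> (\<forall>k\<in>{a..a+j}. xs ! k = d))"
proof
  assume "sublist (replicate (Suc j) d) xs"
  then obtain us vs where "xs = us @ replicate (Suc j) d @ vs"
    by (auto simp: sublist_def)
  then show "\<exists>a. a + j < length xs \<and> (\<forall>k\<in>{a..a+j}. xs ! k = d)"
    by (intro exI[of _ "length us"]) (auto simp: nth_append simp del: replicate_Suc)
next
  assume "\<exists>a. a + j < length xs \<and> (\<forall>k\<in>{a..a+j}. xs ! k = d)"
  then obtain a where a: "a + j < length xs" "\<forall>k\<in>{a..a+j}. xs ! k = d" by blast
  have "take (Suc j) (drop a xs) = replicate (Suc j) d"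
    using a by (intro nth_equalityI) (auto simp del: replicate_Suc)
  then show "sublist (replicate (Suc j) d) xs"
    by (metis sublist_drop sublist_order.order_trans sublist_take)
qed

section \<open>The two lines as a word of marks\<close>

text \<open>The lower line is marked by \<open>Up\<close>, the upper line by \<open>Down\<close>.\<close>

fun line_marks :: "nat \<Rightarrow> nat list \<Rightarrow> step list" where
  "line_marks m [] = []"
| "line_marks m (x # xs) = (if x < m then Up # line_marks x xs else Down # line_marks m xs)"

lemma length_line_marks [simp]: "length (line_marks m xs) = length xs"
  by (induction xs arbitrary: m) auto

lemma line_marks_nth_Up_iff:
  "k < length xs \<Longrightarrow> line_marks m xs ! k = Up \<longleftrightarrow> xs ! k < m \<and> (\<forall>l<k. xs ! k < xs ! l)"
proof (induction xs arbitrary: m k)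
  case (Cons x xs)
  show ?case
    using Cons by (cases k) (auto simp: All_less_Suc2)
qed simp

text \<open>The marks record strict left-to-right minima, \<open>on_lower\<close> weak ones; for
  distinct entries the two agree.\<close>

lemma line_marks_nth_Down_iff:
  assumes "distinct xs" "\<forall>x\<in>set xs. x < m" "k < length xs"
  shows "line_marks m xs ! k = Down \<longleftrightarrow> on_upper xs k"
proof -
  have "(\<forall>l<k. xs ! k < xs ! l) \<longleftrightarrow> (\<forall>l<k. xs ! k \<le> xs ! l)"
    using assms(1,3) by (auto simp: le_less nth_eq_iff_index_eq)
  then have "line_marks m xs ! k = Up \<longleftrightarrow> on_lower xs k"
    using assms(2,3) line_marks_nth_Up_iff on_lower_iff_left_to_right_minimum by simp
  then show ?thesis by (metis step.distinct(1) step.exhaust)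
qed

section \<open>The statistic \<open>gamma_U\<close> as the longest run of upper entries\<close>

lemma subseq_nth_Cons:
  assumes "i < length xs" "subseq ys (drop (Suc i) xs)"
  shows "subseq (xs ! i # ys) xs"
proof -
  have "subseq (xs ! i # ys) (take i xs @ xs ! i # drop (Suc i) xs)"
    using assms(2) by (intro subseq_drop_many) simp
  then show ?thesis using id_take_nth_drop[OF assms(1)] by simp
qed

lemma subseq_three_nth:
  assumes "i < j" "j < k" "k < length xs"
  shows "subseq [xs ! i, xs ! j, xs ! k] xs"
proof -
  have 1: "subseq [xs ! k] (drop (Suc j) xs)"
    using subseq_nth_Cons[of "k - Suc j" "drop (Suc j) xs" "[]"] assms by simp
  have "subseq [xs ! j, xs ! k] (drop (Suc i) xs)"
    using subseq_nth_Cons[of "j - Suc i" "drop (Suc i) xs" "[xs ! k]"] assms 1 by simp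
  then show ?thesis using assms by (intro subseq_nth_Cons) auto
qed

text \<open>An upper entry exceeds some entry to its left, so a larger entry after it would complete
  an increasing triple.\<close>

lemma on_upper_decreasing:
  assumes "avoids_increasing 3 \<pi>" "on_upper \<pi> i" "i \<le> k" "k < length \<pi>"
  shows "\<pi> ! k \<le> \<pi> ! i"
proof (rule ccontr)
  assume "\<not> ?thesis"
  moreover from assms(2) obtain l where "l < i" "\<pi> ! l < \<pi> ! i"
    by (auto simp: on_upper_iff_covers_lower[of \<pi> i] covers_def)
  ultimately show False
    using assms subseq_three_nth[of l i k \<pi>]
    by (cases "i = k") (auto simp: avoids_increasing_3_iff not_le)
qed

lemma sorted_wrt_nths:
  assumes "\<And>i k. i \<in> I \<Longrightarrow> k \<in> I \<Longrightarrow> i < k \<Longrightarrow> k < length xs \<Longrightarrow> P (xs ! i) (xs ! k)"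
  shows "sorted_wrt P (nths xs I)"
  using assms
proof (induction xs arbitrary: I)
  case (Cons x xs)
  have "sorted_wrt P (nths xs {j. Suc j \<in> I})"
    by (rule Cons.IH) (use Cons.prems[of "Suc i" "Suc k" for i k] in auto)
  moreover have "P x y" if "0 \<in> I" "y \<in> set (nths xs {j. Suc j \<in> I})" for y
    using Cons.prems[of 0 "Suc k" for k] that by (auto simp: set_nths)
  ultimately show ?case by (auto simp: nths_Cons)
qed simp

lemma avoids_increasing_2_if_sorted_ge:
  assumes "sorted_wrt (\<ge>) xs"
  shows "avoids_increasing 2 xs"
  unfolding avoids_increasing_def
proof (rule notI, elim exE conjE)
  fix ys :: "nat list"
  assume ys: "subseq ys xs" "length ys = 2" "sorted_wrt (<) ys"
  then obtain I where "ys = nths xs I" by (auto simp: subseq_conv_nths)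
  then have "sorted_wrt (\<ge>) ys"
    using assms by (auto intro!: sorted_wrt_nths dest: sorted_wrt_nth_less)
  with ys(2,3) show False by (auto simp: numeral_2_eq_2 length_Suc_conv)
qed

lemma sorted_ge_rescale:
  assumes "sorted_wrt (\<ge>) xs"
  shows "sorted_wrt (\<ge>) (rescale xs)"
proof -
  have "card {y \<in> set xs. y \<le> b} \<le> card {y \<in> set xs. y \<le> a}" if "b \<le> a" for a b
    using that by (intro card_mono) auto
  then show ?thesis
    unfolding rescale_def sorted_wrt_map by (intro sorted_wrt_mono_rel[OF _ assms]) simp
qed

lemma length_generated_subperm:
  assumes "i < length \<pi>"
  shows "length (generated_subperm \<pi> i) = card (max_block \<pi> i)"
proof -
  have "{k. k < length \<pi> \<and> k \<in> max_block \<pi> i} = max_block \<pi> i"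
    using is_block_max_block[OF assms] by (auto simp: is_block_def)
  then show ?thesis
    by (simp add: generated_subperm_def generated_string_def rescale_def length_nths)
qed

lemma gamma_U_le_iff:
  "gamma_U \<pi> \<le> j \<longleftrightarrow>
    (\<forall>i<length \<pi>. nontrivial_decreasing_subperm \<pi> i \<longrightarrow> card (max_block \<pi> i) \<le> j)"
proof -
  have "finite {length (generated_subperm \<pi> i) |i.
      i < length \<pi> \<and> nontrivial_decreasing_subperm \<pi> i}" by simp
  then show ?thesis
    unfolding gamma_U_def by (auto simp: length_generated_subperm)
qed

text \<open>In a 123-avoiding permutation, an upper entry generates the stretch of upper entries that
  ends in it: the lower entry before that stretch is smaller, and so is whatever comes next.\<close>

lemma nontrivial_decreasing_subperm_if_run:
  assumes "avoids_increasing 3 \<pi>" "on_upper \<pi> i" "i < length \<pi>"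
  shows "nontrivial_decreasing_subperm \<pi> i"
proof -
  let ?M = "max_block \<pi> i"
  have blk: "is_block \<pi> i ?M" using is_block_max_block assms(3) by blast
  then obtain a b where M: "?M = {a..b}" "a \<le> i" "i \<le> b" "b < length \<pi>"
    by (auto simp: is_block_def)
  have ge: "\<pi> ! i \<le> \<pi> ! k" if "k \<in> ?M" for k
    using blk that by (auto simp: is_block_def)
  obtain l where l: "l < i" "\<pi> ! l < \<pi> ! i"
    using assms(2) by (auto simp: on_upper_iff_covers_lower[of \<pi> i] covers_def)
  \<comment> \<open>The smaller entry at \<open>l\<close> lies outside the block and to its left. A
    left-to-right minimum inside the block would be at most \<open>\<pi> ! l\<close>, hence below
    \<open>\<pi> ! i\<close>.\<close>
  have up: "on_upper \<pi> k" if k: "k \<in> ?M" for k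
  proof (rule ccontr)
    assume "on_lower \<pi> k"
    then have min: "\<forall>l<k. \<pi> ! k \<le> \<pi> ! l" by (simp add: on_lower_iff_left_to_right_minimum)
    have "l \<notin> ?M" using ge[of l] l(2) by auto
    then have "l < k" using k M l(1) by auto
    with min ge[OF k] l(2) show False by fastforce
  qed
  have "sorted_wrt (\<ge>) (generated_string \<pi> i)"
    unfolding generated_string_def
    by (rule sorted_wrt_nths) (use on_upper_decreasing[OF assms(1) up] in auto)
  then have "decreasing_subperm \<pi> i"
    unfolding decreasing_subperm_def generated_subperm_def
    by (intro avoids_increasing_2_if_sorted_ge sorted_ge_rescale)
  with up show ?thesis by (simp add: nontrivial_decreasing_subperm_def)
qed

text \<open>Upper entries decrease, so \<open>j + 1\<close> adjacent ones form a block of the last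
  and smallest of them, whose sub-permutation is then non-trivial and of size above
  \<open>j\<close>. Conversely, the block of a non-trivial sub-permutation is itself a run of upper
  entries.\<close>

lemma gamma_U_le_iff_no_run:
  assumes "avoids_increasing 3 \<pi>"
  shows "gamma_U \<pi> \<le> j \<longleftrightarrow> \<not> (\<exists>a. a + j < length \<pi> \<and> (\<forall>k\<in>{a..a+j}. on_upper \<pi> k))"
proof
  assume g: "gamma_U \<pi> \<le> j"
  show "\<not> (\<exists>a. a + j < length \<pi> \<and> (\<forall>k\<in>{a..a+j}. on_upper \<pi> k))"
  proof (rule notI, elim exE conjE)
    fix a assume a: "a + j < length \<pi>" "\<forall>k\<in>{a..a+j}. on_upper \<pi> k"
    have "is_block \<pi> (a + j) {a..a+j}"
      using a on_upper_decreasing[OF assms] by (auto simp: is_block_def)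
    then have "{a..a+j} \<subseteq> max_block \<pi> (a + j)" by (rule max_block_greatest)
    moreover have "finite (max_block \<pi> (a + j))"
      using is_block_max_block[OF a(1)] by (auto simp: is_block_def)
    ultimately have "card {a..a+j} \<le> card (max_block \<pi> (a + j))" by (rule card_mono[rotated])
    moreover have "card (max_block \<pi> (a + j)) \<le> j"
      using g a nontrivial_decreasing_subperm_if_run[OF assms] by (auto simp: gamma_U_le_iff)
    ultimately show False by simp
  qed
next
  assume r: "\<not> (\<exists>a. a + j < length \<pi> \<and> (\<forall>k\<in>{a..a+j}. on_upper \<pi> k))"
  show "gamma_U \<pi> \<le> j"
    unfolding gamma_U_le_iff
  proof (intro allI impI)
    fix i assume i: "i < length \<pi>" "nontrivial_decreasing_subperm \<pi> i"
    obtain a b where M: "max_block \<pi> i = {a..b}" "b < length \<pi>"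
      using is_block_max_block[OF i(1)] by (auto simp: is_block_def)
    show "card (max_block \<pi> i) \<le> j"
    proof (rule ccontr)
      assume "\<not> ?thesis"
      with M have "a + j \<le> b" by auto
      moreover have "\<forall>k\<in>{a..b}. on_upper \<pi> k"
        using i(2) M(1) by (auto simp: nontrivial_decreasing_subperm_def)
      ultimately have "a + j < length \<pi> \<and> (\<forall>k\<in>{a..a+j}. on_upper \<pi> k)"
        using M(2) by auto
      with r show False by blast
    qed
  qed
qed

section \<open>The path of a permutation and its runs of down steps\<close>

fun path_of :: "nat \<Rightarrow> nat list \<Rightarrow> step list" where
  "path_of m [] = []"
| "path_of m (x # xs) =
     (if x < m then replicate (m - x) Up @ Down # path_of x xs else Down # path_of m xs)"

text \<open>A new minimum resets both budgets, but in the path its own down step uses up one unit at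
  once; hence \<open>Suc j\<close> against \<open>j\<close>. The budget \<open>c\<close> is the same
  on both sides because it concerns the entries before the next minimum.\<close>

lemma bounded_runs_path_of:
  "bounded_runs Down (Suc j) c (path_of m xs) \<longleftrightarrow> bounded_runs Down j c (line_marks m xs)"
proof (induction xs arbitrary: m c)
  case (Cons x xs)
  then show ?case
    using bounded_runs_append_replicate[of Up Down "Suc j" c "m - Suc x"]
    by (auto simp: Suc_diff_Suc simp del: replicate_Suc)
qed simp

lemma gamma_U_le_iff_path_of:
  assumes "distinct \<pi>" "set \<pi> = {1..n}" "avoids_increasing 3 \<pi>"
  shows "gamma_U \<pi> \<le> j \<longleftrightarrow> \<not> sublist (replicate (j + 2) Down) (path_of (Suc n) \<pi>)"
proof (cases \<pi>)
  case Nil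
  then show ?thesis by (simp add: gamma_U_le_iff)
next
  case (Cons x xs)
  then have "x \<in> {1..n}" using assms(2) by (metis list.set_intros(1))
  then have "x < Suc n" by simp
  \<comment> \<open>Both words begin with \<open>Up\<close>, which resets the budget, so
    \<open>c\<close> and \<open>d\<close> can be chosen independently, as the different bounds
    \<open>Suc j\<close> and \<open>j\<close> require below.\<close>
  then have start: "bounded_runs Down (Suc j) c (path_of (Suc n) \<pi>) \<longleftrightarrow>
      bounded_runs Down j d (line_marks (Suc n) \<pi>)" for c d
    using Cons by (simp add: bounded_runs_path_of Suc_diff_le bounded_runs_append_replicate
        del: replicate_Suc)
  have "gamma_U \<pi> \<le> j \<longleftrightarrow> \<not> sublist (replicate (Suc j) Down) (line_marks (Suc n) \<pi>)"
    using assms line_marks_nth_Down_iff[of \<pi> "Suc n"]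
    by (auto simp: gamma_U_le_iff_no_run sublist_replicate_iff simp del: replicate_Suc)
  also have "\<dots> \<longleftrightarrow> \<not> sublist (replicate (Suc (Suc j)) Down) (path_of (Suc n) \<pi>)"
    using start[of "Suc j" j] bounded_runs_same_iff by metis
  finally show ?thesis by simp
qed

section \<open>Dyck paths described by heights\<close>

fun nonneg_from :: "nat \<Rightarrow> step list \<Rightarrow> bool" where
  "nonneg_from h [] \<longleftrightarrow> True"
| "nonneg_from h (Up # p) \<longleftrightarrow> nonneg_from (Suc h) p"
| "nonneg_from h (Down # p) \<longleftrightarrow> h > 0 \<and> nonneg_from (h - 1) p"

lemma nonneg_from_iff:
  "nonneg_from h p \<longleftrightarrow> (\<forall>q. prefix q p \<longrightarrow> count_list q Down \<le> count_list q Up + h)"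
proof (induction h p rule: nonneg_from.induct)
  case (2 h p)
  then show ?case by (auto simp: prefix_Cons all_conj_distrib)
next
  case (3 h p)
  show ?case
  proof (cases h)
    case 0
    then show ?thesis by (auto intro!: exI[of _ "[Down]"])
  next
    case (Suc h')
    with 3 show ?thesis by (auto simp: prefix_Cons)
  qed
qed auto

lemma dyck_paths_iff:
  "p \<in> dyck_paths n \<longleftrightarrow> count_list p Up = n \<and> count_list p Down = n \<and> nonneg_from 0 p"
  by (simp add: dyck_paths_def nonneg_from_iff)

lemma nonneg_from_replicate_Up:
  "nonneg_from h (replicate k Up @ p) \<longleftrightarrow> nonneg_from (h + k) p"
  by (induction k arbitrary: h) auto

lemma count_list_replicate: "count_list (replicate k x) y = (if x = y then k else 0)"
  by (induction k) auto

lemma count_Down_path_of: "count_list (path_of m xs) Down = length xs"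
  by (induction xs arbitrary: m) (auto simp: count_list_replicate)

section \<open>The bijection between permutations and Dyck paths\<close>

text \<open>\<open>S\<close> holds the skipped values above the current minimum, and its cardinality
  is the current height. A new minimum \<open>x\<close> adds the \<open>m - x - 1\<close> values
  between \<open>x\<close> and \<open>m\<close>, the net rise of its steps; an upper entry removes
  itself from \<open>S\<close> by one down step.\<close>

lemma path_of_nonneg:
  assumes "distinct xs" "set xs = {1..<m} \<union> S" "S \<subseteq> {m<..}" "av123_from m xs" "m \<ge> 1"
  shows "nonneg_from (card S) (path_of m xs) \<and> count_list (path_of m xs) Up = m - 1"
  using assms
proof (induction xs arbitrary: m S)
  case (Cons x xs)
  have "finite S" using Cons.prems(2) by (metis finite_Un finite_set)
  show ?case
  proof (cases "x < m")
    case True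
    let ?S = "{x<..<m} \<union> S"
    have x: "x \<ge> 1" using True Cons.prems(2,3) by (auto dest: arg_cong[where f = "\<lambda>A. x \<in> A"])
    have "set xs = {1..<m} \<union> S - {x}" using Cons.prems(1,2) by auto
    also have "\<dots> = {1..<x} \<union> ?S" using True x Cons.prems(3) by auto
    finally have "nonneg_from (card ?S) (path_of x xs) \<and> count_list (path_of x xs) Up = x - 1"
      using True x Cons.prems by (intro Cons.IH) auto
    moreover have "card ?S = m - Suc x + card S"
      using \<open>finite S\<close> Cons.prems(3) by (subst card_Un_disjoint) auto
    moreover have "card S + (m - x) - 1 = m - Suc x + card S" using True by simp
    ultimately show ?thesis
      using True x by (simp add: nonneg_from_replicate_Up count_list_replicate)
  next
    case False
    then have x: "x \<in> S" using Cons.prems(2) by auto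
    have "set xs = {1..<m} \<union> S - {x}" using Cons.prems(1,2) by auto
    also have "\<dots> = {1..<m} \<union> (S - {x})" using False by auto
    finally have "nonneg_from (card (S - {x})) (path_of m xs) \<and>
        count_list (path_of m xs) Up = m - 1"
      using False Cons.prems by (intro Cons.IH) auto
    with False x \<open>finite S\<close> show ?thesis by (auto simp: card_gt_0_iff)
  qed
qed auto

text \<open>The first entry can be read off the path: leading up steps give the drop
  \<open>m - x\<close> to a new minimum, while a leading down step means an upper entry, which must
  be the largest value left.\<close>

lemma path_of_inj:
  assumes "distinct xs" "distinct ys" "set xs = set ys" "av123_from m xs" "av123_from m ys"
    "path_of m xs = path_of m ys"
  shows "xs = ys"
  using assms
proof (induction xs arbitrary: m ys)
  case (Cons x xs)
  then obtain y ys' where ys: "ys = y # ys'" by (cases ys) auto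
  have eq: "path_of m (x # xs) = path_of m (y # ys')" using Cons.prems(6) ys by simp
  have tail: "set xs = set ys'" if "x = y" using Cons.prems(1-3) ys that by auto
  consider "x < m" "y < m" | "\<not> x < m" "\<not> y < m" | "x < m" "\<not> y < m" | "\<not> x < m" "y < m"
    by blast
  then show ?case
  proof cases
    case 1
    let ?k = "\<lambda>p. length (takeWhile ((=) Up) p)"
    have "?k (replicate i Up @ Down # p) = i" for i p
      by (induction i) auto
    then have "m - x = m - y" using 1 eq by (metis path_of.simps(2))
    then have "x = y" using 1 by simp
    then show ?thesis using 1 Cons.IH[of ys' y] Cons.prems ys tail by auto
  next
    case 2
    then have "\<forall>z\<in>set xs. z < x" "\<forall>z\<in>set ys'. z < y" using Cons.prems ys by auto
    then have "x = y" using Cons.prems(3) ys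
      by (metis list.set_intros(1) order.asym set_ConsD)
    then show ?thesis using 2 Cons.IH[of ys' m] Cons.prems ys tail by auto
  \<comment> \<open>In the mixed cases one path starts with \<open>Up\<close> and the other with
    \<open>Down\<close>; writing \<open>m - x\<close> as a successor exposes that
    \<open>Up\<close>.\<close>
  qed (use eq in \<open>auto simp: Suc_diff_Suc[symmetric]\<close>)
qed simp

text \<open>Decoding consumes a maximal block of \<open>k\<close> up steps and the next down step at
  once, hence the induction on length. For \<open>k = 0\<close> the positive height provides a
  skipped value, and the largest is placed; for \<open>k > 0\<close> the next entry is the minimum
  \<open>m - k\<close>, which the count of up steps keeps at least 1.\<close>

lemma path_of_surj:
  assumes "finite S" "S \<subseteq> {m<..}" "m \<ge> 1" "nonneg_from (card S) p"
    "count_list p Up = m - 1" "count_list p Down = m - 1 + card S"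
  shows "\<exists>xs. distinct xs \<and> set xs = {1..<m} \<union> S \<and> av123_from m xs \<and> path_of m xs = p"
  using assms
proof (induction p arbitrary: m S rule: length_induct)
  case (1 p)
  note IH = 1(1)[rule_format]
  define k where "k = length (takeWhile ((=) Up) p)"
  define p0 where "p0 = dropWhile ((=) Up) p"
  have "takeWhile ((=) Up) p = replicate k Up"
    unfolding k_def by (intro replicate_eqI) (auto dest: set_takeWhileD)
  then have p: "p = replicate k Up @ p0" unfolding p0_def by (metis takeWhile_dropWhile_id)
  show ?case
  proof (cases p0)
    \<comment> \<open>Without down steps, \<open>m - 1 + card S = 0\<close>, so no value is left to
      place.\<close>
    case Nil
    then have "m = 1" "card S = 0" "k = 0"
      using 1(4-) p by (auto simp: count_list_replicate)
    moreover from \<open>card S = 0\<close> have "S = {}" using 1(2) by simp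
    ultimately show ?thesis using p Nil by (intro exI[of _ "[]"]) auto
  next
    case (Cons s p')
    then have s: "s = Down"
      unfolding p0_def by (cases s) (auto simp: dropWhile_eq_Cons_conv)
    have pk: "p = replicate k Up @ Down # p'" using p Cons s by simp
    have len: "length p' < length p" using pk by simp
    have h: "card S + k > 0" "nonneg_from (card S + k - 1) p'"
      using 1(5) pk by (auto simp: nonneg_from_replicate_Up)
    have cU: "k + count_list p' Up = m - 1" and cD: "Suc (count_list p' Down) = m - 1 + card S"
      using 1(6,7) pk by (auto simp: count_list_replicate)
    show ?thesis
    proof (cases "k = 0")
      case True
      define x where "x = Max S"
      have x: "x \<in> S" "\<forall>y\<in>S. y \<le> x"
        using h True 1(2) by (auto simp: x_def card_gt_0_iff)
      have "card (S - {x}) = card S - 1" using x 1(2) by simp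
      then have "\<exists>xs. distinct xs \<and> set xs = {1..<m} \<union> (S - {x}) \<and> av123_from m xs
          \<and> path_of m xs = p'"
        using 1(2-) len h cU cD True by (intro IH) auto
      then obtain xs where xs: "distinct xs" "set xs = {1..<m} \<union> (S - {x})"
        "av123_from m xs" "path_of m xs = p'" by blast
      have "x > m" using x 1(3) by auto
      moreover have "\<forall>y\<in>set xs. y < x" using xs(2) x \<open>x > m\<close> by (auto simp: less_le)
      ultimately show ?thesis
        using xs x pk True by (intro exI[of _ "x # xs"]) auto
    next
      case False
      define x where "x = m - k"
      have x: "x < m" "1 \<le> x" "m - x = k" using False cU 1(4) by (auto simp: x_def)
      let ?S = "{x<..<m} \<union> S"
      \<comment> \<open>The minimum \<open>x\<close> skips the \<open>k - 1\<close> values strictly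
        between \<open>x\<close> and \<open>m\<close>.\<close>
      have card: "card ?S = card S + k - 1"
        using 1(2,3) x by (subst card_Un_disjoint) auto
      have "\<exists>xs. distinct xs \<and> set xs = {1..<x} \<union> ?S \<and> av123_from x xs \<and> path_of x xs = p'"
      proof (rule IH[OF len])
        show "finite ?S" "?S \<subseteq> {x<..}" "1 \<le> x" using 1(2,3) x by auto
        show "nonneg_from (card ?S) p'" using h(2) card by simp
        show "count_list p' Up = x - 1" using cU by (simp add: x_def)
        show "count_list p' Down = x - 1 + card ?S"
          using cD card x False unfolding x_def by linarith
      qed
      then obtain xs where xs: "distinct xs" "set xs = {1..<x} \<union> ?S"
        "av123_from x xs" "path_of x xs = p'" by blast
      have "x \<notin> set xs" using xs(2) x 1(3) by auto
      moreover have "{1..<m} = insert x ({1..<x} \<union> {x<..<m})" using x(1,2) by auto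
      then have "insert x (set xs) = {1..<m} \<union> S" unfolding xs(2) by blast
      ultimately show ?thesis
        using xs(1,3,4) x pk by (intro exI[of _ "x # xs"]) simp
    qed
  qed
qed

lemma bij_betw_path_of:
  "bij_betw (path_of (Suc n)) {\<pi> \<in> Av123 n. gamma_U \<pi> \<le> j}
     {p \<in> dyck_paths n. avoids_string (replicate (j + 2) Down) p}"
proof -
  \<comment> \<open>The union with \<open>{}\<close> matches the invariant of the preceding lemmas
    at the start, where \<open>S\<close> is empty.\<close>
  have Av: "\<pi> \<in> Av123 n \<longleftrightarrow> distinct \<pi> \<and> set \<pi> = {1..<Suc n} \<union> {} \<and> av123_from (Suc n) \<pi>"
    for \<pi>
    by (auto simp: Av123_def permutations_of_set_def av123_from_Suc_bound
        atLeastLessThanSuc_atLeastAtMost)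
  have gamma: "gamma_U \<pi> \<le> j \<longleftrightarrow> avoids_string (replicate (j + 2) Down) (path_of (Suc n) \<pi>)"
    if "\<pi> \<in> Av123 n" for \<pi>
    using that gamma_U_le_iff_path_of[of \<pi> n j]
    by (auto simp: Av123_def permutations_of_set_def avoids_string_def)
  have "inj_on (path_of (Suc n)) (Av123 n)"
    by (rule inj_onI) (use path_of_inj[of _ _ "Suc n"] in \<open>auto simp: Av\<close>)
  moreover have "path_of (Suc n) ` Av123 n = dyck_paths n"
  proof
    show "path_of (Suc n) ` Av123 n \<subseteq> dyck_paths n"
    proof
      fix p assume "p \<in> path_of (Suc n) ` Av123 n"
      then obtain \<pi> where \<pi>: "\<pi> \<in> Av123 n" "p = path_of (Suc n) \<pi>" by blast
      then have "length \<pi> = n"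
        unfolding Av using distinct_card[of \<pi>] by simp
      then show "p \<in> dyck_paths n"
        using \<pi> path_of_nonneg[of \<pi> "Suc n" "{}"]
        unfolding Av by (simp add: dyck_paths_iff count_Down_path_of)
    qed
    show "dyck_paths n \<subseteq> path_of (Suc n) ` Av123 n"
    proof
      fix p assume "p \<in> dyck_paths n"
      then obtain \<pi> where "\<pi> \<in> Av123 n" "path_of (Suc n) \<pi> = p"
        unfolding Av using path_of_surj[of "{}" "Suc n" p] by (auto simp: dyck_paths_iff)
      then show "p \<in> path_of (Suc n) ` Av123 n" by blast
    qed
  qed
  ultimately have "bij_betw (path_of (Suc n)) (Av123 n) (dyck_paths n)"
    by (simp add: bij_betw_def)
  then show ?thesis
    by (rule bij_betw_Collect) (simp only: gamma)
qed

section \<open>Mirroring paths to exchange runs of up and down steps\<close>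

fun flip :: "step \<Rightarrow> step" where
  "flip Up = Down"
| "flip Down = Up"

lemma flip_flip [simp]: "flip (flip s) = s"
  by (cases s) auto

text \<open>The mirror image in a vertical line: walked backwards, each step changes
  direction.\<close>

definition reverse_path :: "step list \<Rightarrow> step list" where
  "reverse_path p = rev (map flip p)"

lemma reverse_path_invol [simp]: "reverse_path (reverse_path p) = p"
  by (simp add: reverse_path_def rev_map[symmetric] o_def)

lemma count_list_reverse_path [simp]:
  "count_list (reverse_path p) Up = count_list p Down"
  "count_list (reverse_path p) Down = count_list p Up"
  by (induction p) (auto simp: reverse_path_def elim: flip.elims)

lemma sublist_reverse_path_mono:
  "sublist w p \<Longrightarrow> sublist (reverse_path w) (reverse_path p)"
  unfolding reverse_path_def by (simp add: map_mono_sublist)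

lemma sublist_reverse_path_iff:
  "sublist (reverse_path w) p \<longleftrightarrow> sublist w (reverse_path p)"
  by (metis reverse_path_invol sublist_reverse_path_mono)

text \<open>A prefix of the mirrored path is the mirror of a suffix of \<open>p\<close>. The
  complementary prefix of \<open>p\<close> has no excess of down steps and \<open>p\<close> is
  balanced, so that suffix has no excess of up steps.\<close>

lemma reverse_path_in_dyck_paths:
  assumes "p \<in> dyck_paths n"
  shows "reverse_path p \<in> dyck_paths n"
proof -
  have "count_list q Down \<le> count_list q Up" if "prefix q (reverse_path p)" for q
  proof -
    from that obtain r where "reverse_path p = q @ r" by (auto simp: prefix_def)
    then have p: "p = reverse_path r @ reverse_path q"
      by (metis map_append reverse_path_def reverse_path_invol rev_append)
    have "count_list (reverse_path r) Down \<le> count_list (reverse_path r) Up"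
      using assms prefixI[OF p] unfolding dyck_paths_def by blast
    moreover have "count_list p Up = count_list p Down" using assms by (simp add: dyck_paths_def)
    ultimately show ?thesis using p by simp
  qed
  then show ?thesis using assms by (simp add: dyck_paths_def)
qed

text \<open>A run of down steps starts at a positive height, so some up step precedes it.\<close>

lemma avoids_Down_run_iff:
  assumes "p \<in> dyck_paths n"
  shows "avoids_string (replicate (j + 2) Down) p \<longleftrightarrow>
    avoids_string (Up # replicate (j + 2) Down) p"
proof -
  have "sublist (replicate (Suc k) Down) p \<Longrightarrow> nonneg_from 0 p \<Longrightarrow>
      sublist (Up # replicate (Suc k) Down) p" for k
  proof -
    assume s: "sublist (replicate (Suc k) Down) p" and nn: "nonneg_from 0 p"
    then obtain u v where uv: "p = u @ replicate (Suc k) Down @ v" by (auto simp: sublist_def)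
    have "Up \<in> set u"
    proof (rule ccontr)
      assume "Up \<notin> set u"
      then have "count_list (u @ [Down]) Up = 0" by simp
      moreover have "prefix (u @ [Down]) p" using uv by simp
      ultimately show False using nn by (fastforce simp: nonneg_from_iff)
    qed
    then obtain u1 u2 where u: "u = u1 @ Up # u2" "Up \<notin> set u2"
      by (meson split_list_last)
    have "set u2 \<subseteq> {Down}" using u(2) by (metis (full_types) insertI1 step.exhaust subsetI)
    then have "u2 = replicate (length u2) Down"
      by (metis replicate_length_same singletonD subsetD)
    \<comment> \<open>All steps between the last \<open>Up\<close> before the run and the run itself
      are down steps, so the run can be shifted left to start right after that
      \<open>Up\<close>.\<close>
    then have "u2 @ replicate (Suc k) Down = replicate (Suc k) Down @ u2"
      by (metis add.commute replicate_add)
    then have "p = u1 @ (Up # replicate (Suc k) Down) @ (u2 @ v)"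
      using uv u(1) by (metis append.assoc append_Cons)
    then show "sublist (Up # replicate (Suc k) Down) p" by (metis sublist_appendI)
  qed
  from this[of "Suc j"] show ?thesis
    using assms unfolding avoids_string_def dyck_paths_iff
    by (metis add_2_eq_Suc' sublist_Cons_right sublist_order.order_trans sublist_order.order_refl)
qed

lemma bij_betw_reverse_path:
  "bij_betw reverse_path {p \<in> dyck_paths n. avoids_string w p}
     {p \<in> dyck_paths n. avoids_string (reverse_path w) p}"
  by (rule bij_betw_byWitness[where f' = reverse_path])
    (auto simp: avoids_string_def reverse_path_in_dyck_paths sublist_reverse_path_iff)

theorem proposition5:
  fixes n j :: nat
  assumes "n \<ge> 1"
  shows "card {\<pi> \<in> Av123 n. gamma_U \<pi> \<le> j} =
         card {p \<in> dyck_paths n. avoids_string (replicate (j + 2) Up @ [Down]) p}"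
proof -
  \<comment> \<open>The extra leading \<open>Up\<close> supplies the final \<open>Down\<close> of
    the mirrored pattern.\<close>
  have "reverse_path (Up # replicate (j + 2) Down) = replicate (j + 2) Up @ [Down]"
    by (simp add: reverse_path_def del: replicate_Suc)
  moreover have "{p \<in> dyck_paths n. avoids_string (replicate (j + 2) Down) p} =
      {p \<in> dyck_paths n. avoids_string (Up # replicate (j + 2) Down) p}"
    using avoids_Down_run_iff by blast
  ultimately have flip_bij: "bij_betw reverse_path {p \<in> dyck_paths n. avoids_string (replicate (j + 2) Down) p}
      {p \<in> dyck_paths n. avoids_string (replicate (j + 2) Up @ [Down]) p}"
    using bij_betw_reverse_path[of n "Up # replicate (j + 2) Down"] by (simp only:)
  show ?thesis
    by (rule bij_betw_same_card[OF bij_betw_trans[OF bij_betw_path_of flip_bij]])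
qed

end
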